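(* Let $d\ge 1$, let $p\in(0,1/2)$, let $\lambda=(\lambda_{J,\tau})$ be a complete signed tail family, and let $w$ be the coefficient system recovered from $\lambda$ by triangular inversion. Then the following are equivalent: (1) $\lambda$ is the complete finite-threshold signed tail family of some copula at scale $p$, i.e. there is a copula $C$ on $[0,1]^d$ with $\lambda^{(p)}(C)=\lambda$; (2) $w_{I,\sigma}\ge 0$ for all $(I,\sigma)\in\mathcal G_d$; $\lambda_{\{i\},\mathrm L}=\lambda_{\{i\},\mathrm U}=1$ for $i=1,\dots,d$; and $p\sum_{(I,\sigma)\in\mathcal G_d}w_{I,\sigma}\le 1$; (3) $\lambda$ is realized by a geometric witness copula at scale $p$, i.e. there is a geometric witness copula $C$ at scale $p$ with $\lambda^{(p)}(C)=\lambda$.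
   Context: Notation. $[d]=\{1,\dots,d\}$; $\mathcal G_d=\{(I,\sigma):\emptyset\ne I\subseteq[d],\ \sigma\in\{\mathrm L,\mathrm U\}^I\}$, where $\{\mathrm L,\mathrm U\}^I$ is the set of functions $I\to\{\mathrm L,\mathrm U\}$. A complete signed tail family is a real family $\lambda=(\lambda_{J,\tau})$ indexed by all $(J,\tau)\in\mathcal G_d$. Triangular inversion. The coefficient system $w=(w_{I,\sigma})_{(I,\sigma)\in\mathcal G_d}$ recovered from $\lambda$ is defined recursively, by descending $|I|$ from $d$ to $1$, by $w_{I,\sigma}=\lambda_{I,\sigma}-\sum_{K\supsetneq I}\sum_{\rho\in\{\mathrm L,\mathrm U\}^K:\,\rho|_I=\sigma}w_{K,\rho}$. Finite-threshold family of a copula. For $p\in(0,1/2)$ let $L_p=[0,p]$, $M_p=[p,1-p]$, $U_p=[1-p,1]$. For a copula $C$ and $U\sim C$, and $a\in\{\mathrm L,\mathrm M,\mathrm U\}^d$, let $q_a^{(p)}=\Pr(U\in B_a^{(p)})$, where $B_a^{(p)}$ is the product of the intervals $L_p$, $M_p$, $U_p$ chosen in coordinate $i$ according to $a_i=\mathrm L,\mathrm M,\mathrm U$ (a partition modulo null sets). For $(J,\tau)\in\mathcal G_d$, $\lambda^{(p)}_{J,\tau}(C)=\frac1p\sum_{a:\,a|_J=\tau}q_a^{(p)}$, and $\lambda^{(p)}(C)=(\lambda^{(p)}_{J,\tau}(C))$. Geometric witness copula at scale $p_0\in(0,1/2)$. For $(I,\sigma)\in\mathcal G_d$ let $\mu_{I,\sigma}^{(p_0)}$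 be the law of $(U_1,\dots,U_d)$ with $U_i=p_0Z$ if $i\in I,\sigma_i=\mathrm L$; $U_i=1-p_0Z$ if $i\in I,\sigma_i=\mathrm U$; $U_i=p_0+(1-2p_0)V_i$ if $i\notin I$, where $Z$ and the $V_i$ are independent and uniform on $[0,1]$. Let $\mu_0^{(p_0)}$ be the law of $(p_0+(1-2p_0)V_i)_{i=1}^d$ with $V_i$ i.i.d. uniform on $[0,1]$. For a nonnegative weight system $v=(v_{I,\sigma})_{(I,\sigma)\in\mathcal G_d}$ with $m_0=1-p_0\sum v_{I,\sigma}\ge0$, put $\mu^{(v,p_0)}=m_0\mu_0^{(p_0)}+\sum_{(I,\sigma)\in\mathcal G_d}p_0v_{I,\sigma}\,\mu_{I,\sigma}^{(p_0)}$. If $\mu^{(v,p_0)}$ has uniform one-dimensional margins, its distribution function $C^{(v,p_0)}$ is called a geometric witness copula at scale $p_0$. *)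

theory Defs
  imports "HOL-Probability.Probability"
begin

datatype level = Lower | Middle | Upper

text \<open>
  Elements of a power such as \<open>{L, U}\<^sup>I\<close> are encoded as extensional functions on the index set, so that
  restriction of a pattern is \<^const>\<open>restrict\<close> and index sets of sums are finite.
\<close>

definition sides :: "level set" where
  "sides = {Lower, Upper}"

definition signed_sets :: "nat \<Rightarrow> (nat set \<times> (nat \<Rightarrow> level)) set" where
  "signed_sets d = {(I, \<sigma>). I \<noteq> {} \<and> I \<subseteq> {1..d} \<and> \<sigma> \<in> I \<rightarrow>\<^sub>E sides}"

text \<open>
  A signed family is a function of \<open>I\<close> and \<open>\<sigma>\<close>; only its values on \<^const>\<open>signed_sets\<close> matter.
\<close>

type_synonym signed_family = "nat set \<Rightarrow> (nat \<Rightarrow> level) \<Rightarrow> real"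

function triangular_inversion :: "nat \<Rightarrow> signed_family \<Rightarrow> signed_family" where
  "triangular_inversion d lam I \<sigma> =
     lam I \<sigma> - (\<Sum>K\<in>{K. I \<subset> K \<and> K \<subseteq> {1..d}}.
                  \<Sum>\<rho>\<in>{\<rho> \<in> K \<rightarrow>\<^sub>E sides. restrict \<rho> I = \<sigma>}. triangular_inversion d lam K \<rho>)"
  by pat_completeness auto
termination
proof (relation "Wellfounded.measure (\<lambda>(d, lam, I, \<sigma>). d - card I)", goal_cases)
  case (2 d lam I \<sigma> K \<rho>)
  then have "I \<subset> K" "K \<subseteq> {1..d}"
    by auto
  then have "card I < card K" "card K \<le> d"
    using psubset_card_mono[of K I] card_mono[of "{1..d}" K] finite_subset[of K "{1..d}"] by auto
  then show ?case
    by simp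
qed simp

declare triangular_inversion.simps [simp del]

text \<open>
  Probability laws on \<open>\<real>\<^sup>d\<close> with all one-dimensional margins uniform on \<open>[0, 1]\<close>; such a law is
  automatically concentrated on the unit cube.
\<close>

abbreviation Rn :: "nat \<Rightarrow> (nat \<Rightarrow> real) measure" where
  "Rn d \<equiv> PiM {1..d} (\<lambda>_. borel)"

abbreviation uniform01 :: "real measure" where
  "uniform01 \<equiv> uniform_measure lborel {0..1}"

definition uniform_margins :: "nat \<Rightarrow> (nat \<Rightarrow> real) measure \<Rightarrow> bool" where
  "uniform_margins d M \<longleftrightarrow> (\<forall>i\<in>{1..d}. distr M borel (\<lambda>x. x i) = uniform01)"

definition copula_law :: "nat \<Rightarrow> (nat \<Rightarrow> real) measure \<Rightarrow> bool" where
  "copula_law d M \<longleftrightarrow> prob_space M \<and> sets M = sets (Rn d) \<and> uniform_margins d M"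

text \<open>
  \<open>C\<close> is the distribution function of \<open>M\<close> on the unit cube; the values of \<open>C\<close> elsewhere are
  irrelevant.
\<close>

definition has_df :: "nat \<Rightarrow> (nat \<Rightarrow> real) measure \<Rightarrow> ((nat \<Rightarrow> real) \<Rightarrow> real) \<Rightarrow> bool" where
  "has_df d M C \<longleftrightarrow>
     (\<forall>u \<in> {1..d} \<rightarrow>\<^sub>E {0..1}. C u = measure M (\<Pi>\<^sub>E i\<in>{1..d}. {..u i}))"

definition copula :: "nat \<Rightarrow> ((nat \<Rightarrow> real) \<Rightarrow> real) \<Rightarrow> bool" where
  "copula d C \<longleftrightarrow> (\<exists>M. copula_law d M \<and> has_df d M C)"

definition law_of :: "nat \<Rightarrow> ((nat \<Rightarrow> real) \<Rightarrow> real) \<Rightarrow> (nat \<Rightarrow> real) measure" where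
  "law_of d C = (THE M. copula_law d M \<and> has_df d M C)"

text \<open>The distribution function determines the law, so \<^const>\<open>law_of\<close> is well defined.\<close>

lemma copula_law_AE:
  assumes "copula_law d M" 
  shows "AE y in M. \<forall>i\<in>{1..d}. 0 \<le> y i \<and> y i \<le> 1"
proof (rule AE_finite_allI)
  fix i assume i: "i \<in> {1..d}"
  have [measurable]: "(\<lambda>x. x i) \<in> borel_measurable M"
    using assms measurable_component_singleton[OF i, of "\<lambda>_. borel::real measure"]
    by (simp add: copula_law_def cong: measurable_cong_sets)
  have "AE x in uniform01. 0 \<le> x \<and> x \<le> 1"
    by (subst AE_uniform_measure) auto
  moreover have "distr M borel (\<lambda>x. x i) = uniform01"
    using assms i unfolding copula_law_def uniform_margins_def by blast
  ultimately have "AE x in distr M borel (\<lambda>x. x i). 0 \<le> x \<and> x \<le> 1"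
    by metis
  then show "AE y in M. 0 \<le> y i \<and> y i \<le> 1"
    by (subst (asm) AE_distr_iff) auto
qed simp

lemma copula_law_unique:
  assumes M: "copula_law d M" "has_df d M C" and N: "copula_law d N" "has_df d N C"
  shows "M = N"
proof -
  define B where "B = (\<lambda>x. \<Pi>\<^sub>E i\<in>{1..d}. {..x i :: real})"
  have setsM: "sets M = sets (Rn d)" "sets N = sets (Rn d)"
    using M(1) N(1) unfolding copula_law_def by blast+
  have B[measurable]: "B x \<in> sets (Rn d)" for x
    unfolding B_def by (intro sets_PiM_I_finite) auto
  have val: "measure L (B x) = (if \<exists>i\<in>{1..d}. x i < 0 then 0 else C (\<lambda>i\<in>{1..d}. min 1 (x i)))"
    if L: "copula_law d L" "has_df d L C" for L x
  proof (cases "\<exists>i\<in>{1..d}. x i < 0")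
    case True
    have setsL: "sets L = sets (Rn d)"
      using L(1) unfolding copula_law_def by blast
    have "AE y in L. y \<notin> B x"
    proof (rule eventually_mono[OF copula_law_AE[OF L(1)]])
      fix y :: "nat \<Rightarrow> real"
      assume y: "\<forall>i\<in>{1..d}. 0 \<le> y i \<and> y i \<le> 1"
      from True obtain i where "i \<in> {1..d}" "x i < 0"
        by blast
      with y have "\<not> y i \<le> x i"
        by force
      with \<open>i \<in> {1..d}\<close> show "y \<notin> B x"
        by (auto simp: B_def PiE_iff)
    qed
    then have "emeasure L (B x) = emeasure L {}"
      by (intro emeasure_eq_AE) (simp_all only: setsL B sets.empty_sets empty_iff simp_thms)
    then have "measure L (B x) = 0"
      by (simp add: measure_def)
    with True show ?thesis
      by metis
  next
    case False
    have setsL: "sets L = sets (Rn d)"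
      using L(1) unfolding copula_law_def by blast
    let ?u = "\<lambda>i\<in>{1..d}. min 1 (x i)"
    have "AE y in L. y \<in> B x \<longleftrightarrow> y \<in> B ?u"
    proof (rule eventually_mono[OF copula_law_AE[OF L(1)]])
      fix y :: "nat \<Rightarrow> real"
      assume "\<forall>i\<in>{1..d}. 0 \<le> y i \<and> y i \<le> 1"
      then have "y i \<le> x i \<longleftrightarrow> y i \<le> ?u i" if "i \<in> {1..d}" for i
        using that by auto
      then show "y \<in> B x \<longleftrightarrow> y \<in> B ?u"
        by (simp add: B_def PiE_iff)
    qed
    then have "emeasure L (B x) = emeasure L (B ?u)"
      by (intro emeasure_eq_AE) (simp_all only: setsL B)
    then have "measure L (B x) = measure L (B ?u)"
      unfolding measure_def by (rule arg_cong)
    moreover have "?u \<in> {1..d} \<rightarrow>\<^sub>E {0..1}"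
      using False by (auto simp: not_less)
    then have "C ?u = measure L (B ?u)"
      using L(2) unfolding has_df_def B_def by blast
    ultimately show ?thesis
      using False by metis
  qed
  have fin: "finite_measure M" "finite_measure N"
    using M(1) N(1) unfolding copula_law_def prob_space_def by blast+
  have em: "emeasure M (B x) = emeasure N (B x)" for x
    unfolding fin[THEN finite_measure.emeasure_eq_measure] val[OF M] val[OF N] ..
  have "sets (Rn d) = sets (\<Pi>\<^sub>M i\<in>{1..d}. sigma UNIV (range (\<lambda>a::real. {..a})))"
    by (simp add: borel_eq_atMost)
  also have "\<dots> = sets (sigma (\<Pi>\<^sub>E i\<in>{1..d}. UNIV) {{f\<in>(\<Pi>\<^sub>E i\<in>{1..d}. UNIV). \<forall>i\<in>j. f i \<in> A i} | A j.
      j \<in> {{1..d}} \<and> A \<in> Pi j (\<lambda>_. range (\<lambda>a::real. {..a}))})"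
  proof (rule sets_PiM_sigma)
    show "\<exists>S\<subseteq>range (\<lambda>a::real. {..a}). countable S \<and> UNIV = \<Union>S" for i :: nat
      by (rule exI[of _ "range (\<lambda>n. {..real n})"]) (auto simp: real_arch_simple)
  qed auto
  also have "{{f\<in>(\<Pi>\<^sub>E i\<in>{1..d}. UNIV). \<forall>i\<in>j. f i \<in> A i} | A j.
      j \<in> {{1..d}} \<and> A \<in> Pi j (\<lambda>_. range (\<lambda>a::real. {..a}))} = range B" (is "?P = _")
  proof (intro equalityI subsetI)
    fix X assume "X \<in> ?P"
    then obtain A where A: "A \<in> {1..d} \<rightarrow> range (\<lambda>a::real. {..a})"
      and X: "X = {f\<in>(\<Pi>\<^sub>E i\<in>{1..d}. UNIV). \<forall>i\<in>{1..d}. f i \<in> A i}" by auto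
    have "\<forall>i\<in>{1..d}. \<exists>a. A i = {..a}" using A by (auto simp: Pi_iff image_iff)
    then obtain x where "\<forall>i\<in>{1..d}. A i = {..x i}" by metis
    then have "X = B x" unfolding X B_def by (auto simp: PiE_iff extensional_def)
    then show "X \<in> range B" by simp
  next
    fix X assume "X \<in> range B"
    then obtain x where X: "X = B x" by auto
    show "X \<in> ?P" unfolding X
      by (auto simp: B_def PiE_iff extensional_def intro!: exI[of _ "\<lambda>i. {..x i}"])
  qed
  finally have gen: "sets (Rn d) = sigma_sets (\<Pi>\<^sub>E i\<in>{1..d}. UNIV) (range B)"
    by (subst (asm) sets_measure_of) (auto simp: B_def PiE_iff)
  show ?thesis
  proof (rule measure_eqI_generator_eq[where E = "range B" and \<Omega> = "\<Pi>\<^sub>E i\<in>{1..d}. UNIV"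
        and A = "\<lambda>n. B (\<lambda>_. real n)"])
    have "B x \<inter> B y = B (\<lambda>i. min (x i) (y i))" for x y
      by (auto simp: B_def PiE_iff)
    then show "Int_stable (range B)" by (fastforce simp: Int_stable_def)
    show "(\<Union>n. B (\<lambda>_. real n)) = (\<Pi>\<^sub>E i\<in>{1..d}. UNIV)"
    proof (intro equalityI subsetI)
      fix y :: "nat \<Rightarrow> real" assume y: "y \<in> (\<Pi>\<^sub>E i\<in>{1..d}. UNIV)"
      obtain n :: nat where n: "(\<Sum>i\<in>{1..d}. \<bar>y i\<bar>) \<le> real n" using real_arch_simple by blast
      have "y i \<le> real n" if "i \<in> {1..d}" for i
        using member_le_sum[OF that, of "\<lambda>i. \<bar>y i\<bar>"] n by simp
      then have "y \<in> B (\<lambda>_. real n)" using y by (simp add: B_def PiE_iff)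
      then show "y \<in> (\<Union>n. B (\<lambda>_. real n))" by blast
    qed (auto simp: B_def PiE_iff)
    show "emeasure M (B (\<lambda>_. real n)) \<noteq> \<infinity>" for n
      by (simp add: finite_measure.emeasure_finite[OF fin(1)])
    show "range B \<subseteq> Pow (\<Pi>\<^sub>E i\<in>{1..d}. UNIV)"
      by (auto simp: B_def PiE_iff)
    show "emeasure M X = emeasure N X" if "X \<in> range B" for X
      using that em by blast
  qed (simp_all only: setsM gen, blast)
qed

lemma law_of_eq: "copula_law d M \<Longrightarrow> has_df d M C \<Longrightarrow> law_of d C = M"
  unfolding law_of_def by (rule the_equality) (auto intro: copula_law_unique)

fun cell :: "real \<Rightarrow> level \<Rightarrow> real set" where
  "cell p Lower = {0..p}"
| "cell p Middle = {p..1 - p}"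
| "cell p Upper = {1 - p..1}"

definition cell_prob :: "nat \<Rightarrow> real \<Rightarrow> ((nat \<Rightarrow> real) \<Rightarrow> real) \<Rightarrow> (nat \<Rightarrow> level) \<Rightarrow> real" where
  "cell_prob d p C a = measure (law_of d C) (\<Pi>\<^sub>E i\<in>{1..d}. cell p (a i))"

definition tail_family :: "nat \<Rightarrow> real \<Rightarrow> ((nat \<Rightarrow> real) \<Rightarrow> real) \<Rightarrow> signed_family" where
  "tail_family d p C J \<tau> =
     1 / p * (\<Sum>a\<in>{a \<in> {1..d} \<rightarrow>\<^sub>E UNIV. restrict a J = \<tau>}. cell_prob d p C a)"

definition has_tail_family :: "nat \<Rightarrow> real \<Rightarrow> ((nat \<Rightarrow> real) \<Rightarrow> real) \<Rightarrow> signed_family \<Rightarrow> bool" where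
  "has_tail_family d p C lam \<longleftrightarrow> (\<forall>(J, \<tau>)\<in>signed_sets d. tail_family d p C J \<tau> = lam J \<tau>)"

text \<open>
  The product measure supplies the independent uniform variables: \<open>Z\<close> and \<open>V\<^sub>1, \<dots>, V\<^sub>d\<close>.
\<close>

definition witness_component ::
    "nat \<Rightarrow> real \<Rightarrow> nat set \<Rightarrow> (nat \<Rightarrow> level) \<Rightarrow> (nat \<Rightarrow> real) measure" where
  "witness_component d p I \<sigma> =
     distr (uniform01 \<Otimes>\<^sub>M PiM {1..d} (\<lambda>_. uniform01)) (Rn d)
       (\<lambda>(z, v). \<lambda>i\<in>{1..d}.
          if i \<in> I then (if \<sigma> i = Lower then p * z else 1 - p * z)
          else p + (1 - 2 * p) * v i)"

definition witness_base :: "nat \<Rightarrow> real \<Rightarrow> (nat \<Rightarrow> real) measure" where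
  "witness_base d p =
     distr (PiM {1..d} (\<lambda>_. uniform01)) (Rn d) (\<lambda>v. \<lambda>i\<in>{1..d}. p + (1 - 2 * p) * v i)"

definition base_mass :: "nat \<Rightarrow> real \<Rightarrow> signed_family \<Rightarrow> real" where
  "base_mass d p v = 1 - p * (\<Sum>(I, \<sigma>)\<in>signed_sets d. v I \<sigma>)"

definition witness_law :: "nat \<Rightarrow> real \<Rightarrow> signed_family \<Rightarrow> (nat \<Rightarrow> real) measure" where
  "witness_law d p v =
     measure_of (space (Rn d)) (sets (Rn d))
       (\<lambda>A. ennreal (base_mass d p v) * emeasure (witness_base d p) A
          + (\<Sum>(I, \<sigma>)\<in>signed_sets d.
               ennreal (p * v I \<sigma>) * emeasure (witness_component d p I \<sigma>) A))"

lemma emeasure_witness_law: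
  assumes "A \<in> sets (Rn d)"
  shows "emeasure (witness_law d p v) A =
    ennreal (base_mass d p v) * emeasure (witness_base d p) A
      + (\<Sum>(I, \<sigma>)\<in>signed_sets d.
           ennreal (p * v I \<sigma>) * emeasure (witness_component d p I \<sigma>) A)"
proof -
  let ?f = "\<lambda>A. ennreal (base_mass d p v) * emeasure (witness_base d p) A
      + (\<Sum>(I, \<sigma>)\<in>signed_sets d.
           ennreal (p * v I \<sigma>) * emeasure (witness_component d p I \<sigma>) A)"
  have "countably_additive (sets (Rn d)) ?f"
  proof (rule countably_additiveI)
    fix A :: "nat \<Rightarrow> (nat \<Rightarrow> real) set"
    assume A: "range A \<subseteq> sets (Rn d)" "disjoint_family A"
    have b: "(\<Sum>n. emeasure (witness_base d p) (A n)) = emeasure (witness_base d p) (\<Union>n. A n)"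
      using A by (intro suminf_emeasure) (auto simp: witness_base_def)
    have c: "(\<Sum>n. emeasure (witness_component d p I \<sigma>) (A n))
        = emeasure (witness_component d p I \<sigma>) (\<Union>n. A n)" for I \<sigma>
      using A by (intro suminf_emeasure) (auto simp: witness_component_def)
    show "(\<Sum>n. ?f (A n)) = ?f (\<Union>n. A n)"
      by (simp add: suminf_add[symmetric] suminf_sum case_prod_unfold b c)
  qed
  moreover have "positive (sets (Rn d)) ?f"
    by (auto simp: positive_def case_prod_unfold)
  ultimately show ?thesis
    unfolding witness_law_def
    using assms sets.sigma_algebra_axioms[of "Rn d"] 
    by (intro emeasure_measure_of_sigma) auto
qed

definition geometric_witness_copula :: "nat \<Rightarrow> real \<Rightarrow> ((nat \<Rightarrow> real) \<Rightarrow> real) \<Rightarrow> bool" where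
  "geometric_witness_copula d p C \<longleftrightarrow>
     (\<exists>v. (\<forall>(I, \<sigma>)\<in>signed_sets d. v I \<sigma> \<ge> 0) \<and> base_mass d p v \<ge> 0
        \<and> uniform_margins d (witness_law d p v) \<and> has_df d (witness_law d p v) C)"

end

theory Submission
  imports Defs
begin

text \<open>
  The thresholds \<open>p\<close> and \<open>1 - p\<close> cut the cube into cells, one for each word over
  \<^const>\<open>Lower\<close>, \<^const>\<open>Middle\<close>, \<^const>\<open>Upper\<close>. Recording where a word is not
  \<^const>\<open>Middle\<close>, and which side it takes there, matches the words other than the constant
  \<^const>\<open>Middle\<close> with the signed sets. Under this matching, the tail value at \<open>(J, \<tau>)\<close> is the sum
  of the cell probabilities over all signed sets extending \<open>(J, \<tau>)\<close>, divided by \<open>p\<close>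
  (\<open>sum_patterns_eq_sum_extensions\<close>). Such sums form a unitriangular system, so triangular inversion
  returns the cell probabilities divided by \<open>p\<close> (\<open>triangular_inversion_of_tail_family\<close>).

  Hence for a copula the coefficients are nonnegative, \<open>p\<close> times their sum is at most one (the rest is
  the probability of the central cell), and the singleton tails equal one because the margins are
  uniform.

  Conversely, use the coefficients as the weights of a geometric witness. Every component of the
  mixture lives on a single cell, the one of its own signed set. The cell probabilities of the mixture
  are thus \<open>p\<close> times the coefficients (\<open>measure_witness_law_box\<close>), and its tail family is the
  prescribed one. It remains to see that the margins are uniform: each component has, in every
  coordinate, a uniform law on one of the three intervals, and the conditions on singleton tails say
  that the three intervals receive mass in proportion to their lengths
  (\<open>uniform_margins_witness_law\<close>). Finally, a geometric witness with uniform margins is a copula.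
\<close>

section \<open>Signed sets and triangular inversion\<close>

lemma UNIV_level: "UNIV = {Lower, Middle, Upper}"
  using level.exhaust by auto

lemma finite_UNIV_level: "finite (UNIV :: level set)"
  by (simp add: UNIV_level)

lemma finite_patterns: "finite ({1..(d::nat)} \<rightarrow>\<^sub>E (UNIV :: level set))"
  by (rule finite_PiE) (simp_all add: finite_UNIV_level)

lemma finite_signed_sets: "finite (signed_sets d)"
proof (rule finite_subset)
  show "signed_sets d \<subseteq> (SIGMA I : Pow {1..d}. I \<rightarrow>\<^sub>E sides)"
    by (auto simp: signed_sets_def)
  show "finite (SIGMA I : Pow {1..d}. I \<rightarrow>\<^sub>E sides)"
    by (intro finite_SigmaI finite_PiE) (auto simp: sides_def intro: finite_subset)
qed

definition extensions :: "nat \<Rightarrow> nat set \<Rightarrow> (nat \<Rightarrow> level) \<Rightarrow> (nat set \<times> (nat \<Rightarrow> level)) set" where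
  "extensions d J \<tau> = {(K, \<rho>) \<in> signed_sets d. J \<subseteq> K \<and> restrict \<rho> J = \<tau>}"

lemma finite_extensions: "finite (extensions d J \<tau>)"
  by (rule finite_subset[OF _ finite_signed_sets[of d]]) (auto simp: extensions_def)

lemma singleton_signed_set:
  assumes "i \<in> {1..d}" "s \<in> sides"
  shows "({i}, \<lambda>_\<in>{i}. s) \<in> signed_sets d"
  using assms by (auto simp: signed_sets_def)

lemma in_extensions_self: "(J, \<tau>) \<in> signed_sets d \<Longrightarrow> (J, \<tau>) \<in> extensions d J \<tau>"
  by (auto simp: extensions_def signed_sets_def)

text \<open>
  Strict inclusion of the index set in the recursion amounts to leaving out \<open>(J, \<tau>)\<close> itself,
  because an extension to the same set is determined by its restriction.
\<close>

lemma proper_extensions_eq: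
  assumes "(J, \<tau>) \<in> signed_sets d"
  shows "extensions d J \<tau> - {(J, \<tau>)} =
    (SIGMA K : {K. J \<subset> K \<and> K \<subseteq> {1..d}}. {\<rho> \<in> K \<rightarrow>\<^sub>E sides. restrict \<rho> J = \<tau>})"
  using assms by (auto simp: extensions_def signed_sets_def)

lemma triangular_inversion_eq:
  assumes "(J, \<tau>) \<in> signed_sets d"
  shows "triangular_inversion d lam J \<tau> =
    lam J \<tau> - (\<Sum>(K, \<rho>)\<in>extensions d J \<tau> - {(J, \<tau>)}. triangular_inversion d lam K \<rho>)"
proof -
  have "finite {K. J \<subset> K \<and> K \<subseteq> {1..d}}"
    by (rule finite_subset[of _ "Pow {1..d}"]) auto
  moreover have "finite {\<rho> \<in> K \<rightarrow>\<^sub>E sides. restrict \<rho> J = \<tau>}" if "K \<subseteq> {1..d}" for K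
  proof (rule finite_subset)
    show "finite (K \<rightarrow>\<^sub>E sides)"
      using that by (intro finite_PiE) (auto simp: sides_def intro: finite_subset)
  qed auto
  ultimately show ?thesis
    by (subst triangular_inversion.simps) (simp add: proper_extensions_eq[OF assms] sum.Sigma)
qed

lemma sum_extensions_triangular_inversion:
  assumes "(J, \<tau>) \<in> signed_sets d"
  shows "(\<Sum>(K, \<rho>)\<in>extensions d J \<tau>. triangular_inversion d lam K \<rho>) = lam J \<tau>"
  using triangular_inversion_eq[OF assms, of lam]
    sum.remove[OF finite_extensions in_extensions_self[OF assms],
      of "\<lambda>(K, \<rho>). triangular_inversion d lam K \<rho>"]
  by simp

text \<open>
  The system that expresses \<open>lam\<close> through \<open>g\<close> is unitriangular for the order of inclusion: the
  equation at \<open>I\<close> involves, besides \<open>g I\<close>, only values at larger sets. Descending induction on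
  the cardinality therefore recovers \<open>g\<close>.
\<close>

lemma triangular_inversion_unique:
  assumes "\<And>J \<tau>. (J, \<tau>) \<in> signed_sets d \<Longrightarrow> lam J \<tau> = (\<Sum>(K, \<rho>)\<in>extensions d J \<tau>. g K \<rho>)"
    and "(I, \<sigma>) \<in> signed_sets d"
  shows "triangular_inversion d lam I \<sigma> = g I \<sigma>"
  using assms(2)
proof (induction "d - card I" arbitrary: I \<sigma> rule: less_induct)
  case less
  have "triangular_inversion d lam K \<rho> = g K \<rho>"
    if "(K, \<rho>) \<in> extensions d I \<sigma> - {(I, \<sigma>)}" for K \<rho>
  proof (rule less.hyps)
    have K: "I \<subset> K" "K \<subseteq> {1..d}"
      using that unfolding proper_extensions_eq[OF less.prems] by auto
    then have "card I < card K" "card K \<le> d"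
      using psubset_card_mono[of K I] card_mono[of "{1..d}" K] finite_subset[of K "{1..d}"] by auto
    then show "d - card K < d - card I"
      by simp
    show "(K, \<rho>) \<in> signed_sets d"
      using that by (auto simp: extensions_def)
  qed
  then have "triangular_inversion d lam I \<sigma> =
      lam I \<sigma> - (\<Sum>(K, \<rho>)\<in>extensions d I \<sigma> - {(I, \<sigma>)}. g K \<rho>)"
    unfolding triangular_inversion_eq[OF less.prems]
    by (auto intro!: sum.cong)
  also have "\<dots> = g I \<sigma>"
    using sum.remove[OF finite_extensions in_extensions_self[OF less.prems],
        of "\<lambda>(K, \<rho>). g K \<rho>"] assms(1)[OF less.prems]
    by simp
  finally show ?case .
qed

section \<open>Full patterns\<close>

text \<open>
  A signed set is a sparse description of a cell of the threshold partition: the coordinates outside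
  the set are those in the middle interval. The empty set, which is not a signed set, describes the
  central cell.
\<close>

definition full_pattern :: "nat \<Rightarrow> nat set \<Rightarrow> (nat \<Rightarrow> level) \<Rightarrow> nat \<Rightarrow> level" where
  "full_pattern d I \<sigma> = (\<lambda>i\<in>{1..d}. if i \<in> I then \<sigma> i else Middle)"

lemma full_pattern_in: "full_pattern d I \<sigma> \<in> {1..d} \<rightarrow>\<^sub>E UNIV"
  by (simp add: full_pattern_def)

text \<open>
  A signed set can be read off from its cell, since signs are never \<^const>\<open>Middle\<close>.
\<close>

lemma tail_of_full_pattern:
  assumes "(I, \<sigma>) \<in> signed_sets d"
  shows "{i \<in> {1..d}. full_pattern d I \<sigma> i \<noteq> Middle} = I" "restrict (full_pattern d I \<sigma>) I = \<sigma>"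
proof -
  have I: "I \<subseteq> {1..d}" "\<sigma> \<in> I \<rightarrow>\<^sub>E sides"
    using assms by (auto simp: signed_sets_def)
  then have "\<sigma> i \<noteq> Middle" if "i \<in> I" for i
    using that by (auto simp: sides_def dest: PiE_mem)
  with I show "{i \<in> {1..d}. full_pattern d I \<sigma> i \<noteq> Middle} = I"
    by (auto simp: full_pattern_def)
  show "restrict (full_pattern d I \<sigma>) I = \<sigma>"
  proof
    fix i
    show "restrict (full_pattern d I \<sigma>) I i = \<sigma> i"
      using subsetD[OF I(1), of i] PiE_arb[OF I(2), of i]
      by (cases "i \<in> I") (auto simp: full_pattern_def)
  qed
qed

lemma full_pattern_inj:
  assumes "(I, \<sigma>) \<in> signed_sets d" "(K, \<rho>) \<in> signed_sets d"
    and "full_pattern d I \<sigma> = full_pattern d K \<rho>"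
  shows "(I, \<sigma>) = (K, \<rho>)"
proof -
  have IK: "I = K"
    using tail_of_full_pattern(1)[OF assms(1)] tail_of_full_pattern(1)[OF assms(2)]
    unfolding assms(3) by (rule trans[OF sym])
  have "\<sigma> = \<rho>"
    using tail_of_full_pattern(2)[OF assms(1)] tail_of_full_pattern(2)[OF assms(2)]
    unfolding assms(3) unfolding IK by (rule trans[OF sym])
  with IK show ?thesis by simp
qed

lemma full_pattern_empty: "full_pattern d {} \<sigma> = (\<lambda>_\<in>{1..d}. Middle)"
  by (simp add: full_pattern_def)

lemma full_pattern_neq_Middle:
  assumes "(K, \<rho>) \<in> signed_sets d"
  shows "full_pattern d K \<rho> \<noteq> (\<lambda>_\<in>{1..d}. Middle)"
proof
  assume "full_pattern d K \<rho> = (\<lambda>_\<in>{1..d}. Middle)"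
  with tail_of_full_pattern(1)[OF assms] have "K = {}" by auto
  with assms show False by (simp add: signed_sets_def)
qed

lemma full_pattern_of_tail:
  assumes "a \<in> {1..d} \<rightarrow>\<^sub>E UNIV" "I = {i \<in> {1..d}. a i \<noteq> Middle}"
  shows "full_pattern d I (restrict a I) = a"
proof
  fix i
  show "full_pattern d I (restrict a I) i = a i"
    using PiE_arb[OF assms(1), of i] by (auto simp: full_pattern_def assms(2))
qed

lemma tail_in_signed_sets:
  assumes "I = {i \<in> {1..d}. a i \<noteq> Middle}" "I \<noteq> {}"
  shows "(I, restrict a I) \<in> signed_sets d"
proof -
  have "a i \<in> sides" if "a i \<noteq> Middle" for i
    using that by (cases "a i") (auto simp: sides_def)
  then show ?thesis
    using assms by (auto simp: signed_sets_def)
qed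

text \<open>
  Prescribing sides on a nonempty set \<open>J\<close> forces the non-middle coordinates of a cell to include
  \<open>J\<close>. So the cells summed in a tail mass correspond to the signed sets that extend \<open>(J, \<tau>)\<close>, and
  tail families become sums of the kind that triangular inversion undoes.
\<close>

lemma sum_patterns_eq_sum_extensions:
  assumes "(J, \<tau>) \<in> signed_sets d"
  shows "(\<Sum>a\<in>{a \<in> {1..d} \<rightarrow>\<^sub>E UNIV. restrict a J = \<tau>}. f a) =
    (\<Sum>(K, \<rho>)\<in>extensions d J \<tau>. f (full_pattern d K \<rho>))"
proof (rule sum.reindex_bij_witness[where i = "\<lambda>(K, \<rho>). full_pattern d K \<rho>"
      and j = "\<lambda>a. ({i \<in> {1..d}. a i \<noteq> Middle}, restrict a {i \<in> {1..d}. a i \<noteq> Middle})"])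
  have J: "J \<noteq> {}" "J \<subseteq> {1..d}" "\<tau> \<in> J \<rightarrow>\<^sub>E sides"
    using assms by (auto simp: signed_sets_def)
  fix a :: "nat \<Rightarrow> level" assume a: "a \<in> {a \<in> {1..d} \<rightarrow>\<^sub>E UNIV. restrict a J = \<tau>}"
  let ?I = "{i \<in> {1..d}. a i \<noteq> Middle}"
  have \<tau>: "\<tau> = restrict a J" using a by simp
  have "a i \<noteq> Middle" if "i \<in> J" for i
    using PiE_mem[OF J(3) that] that by (auto simp: \<tau> sides_def)
  with J have JI: "J \<subseteq> ?I" by auto
  with J have "(?I, restrict a ?I) \<in> signed_sets d" by (intro tail_in_signed_sets) auto
  with JI show "(?I, restrict a ?I) \<in> extensions d J \<tau>"
    by (auto simp: extensions_def \<tau> restrict_def fun_eq_iff)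
  have fp: "full_pattern d ?I (restrict a ?I) = a"
    using a by (intro full_pattern_of_tail) auto
  then show "(case (?I, restrict a ?I) of (K, \<rho>) \<Rightarrow> full_pattern d K \<rho>) = a" by simp
  show "(case (?I, restrict a ?I) of (K, \<rho>) \<Rightarrow> f (full_pattern d K \<rho>)) = f a" using fp by simp
next
  fix b assume "b \<in> extensions d J \<tau>"
  then obtain K \<rho> where b: "b = (K, \<rho>)" "(K, \<rho>) \<in> signed_sets d" "J \<subseteq> K" "restrict \<rho> J = \<tau>"
    by (auto simp: extensions_def)
  note t = tail_of_full_pattern[OF b(2)]
  show "({i \<in> {1..d}. (case b of (K, \<rho>) \<Rightarrow> full_pattern d K \<rho>) i \<noteq> Middle},
      restrict (case b of (K, \<rho>) \<Rightarrow> full_pattern d K \<rho>)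
        {i \<in> {1..d}. (case b of (K, \<rho>) \<Rightarrow> full_pattern d K \<rho>) i \<noteq> Middle}) = b"
    using t b(1) by simp
  have "restrict (full_pattern d K \<rho>) J = restrict (restrict (full_pattern d K \<rho>) K) J"
    using b(3) by (simp add: restrict_restrict Int_absorb1)
  also have "\<dots> = \<tau>" unfolding t(2) by (rule b(4))
  finally show "(case b of (K, \<rho>) \<Rightarrow> full_pattern d K \<rho>) \<in> {a \<in> {1..d} \<rightarrow>\<^sub>E UNIV. restrict a J = \<tau>}"
    using b(1) full_pattern_in by simp
qed

text \<open>
  The central cell is the only one without a signed set. For cell probabilities, its value is the
  slack in the inequality for the total weight.
\<close>

lemma sum_signed_sets_eq_sum_patterns:
  "(\<Sum>(K, \<rho>)\<in>signed_sets d. f (full_pattern d K \<rho>)) =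
     (\<Sum>a\<in>({1..d} \<rightarrow>\<^sub>E UNIV) - {\<lambda>_\<in>{1..d}. Middle}. f a)"
proof -
  have "bij_betw (\<lambda>(K, \<rho>). full_pattern d K \<rho>) (signed_sets d) (({1..d} \<rightarrow>\<^sub>E UNIV) - {\<lambda>_\<in>{1..d}. Middle})"
  proof (rule bij_betw_imageI)
    show "inj_on (\<lambda>(K, \<rho>). full_pattern d K \<rho>) (signed_sets d)"
      by (auto intro!: inj_onI dest: full_pattern_inj)
    show "(\<lambda>(K, \<rho>). full_pattern d K \<rho>) ` signed_sets d = ({1..d} \<rightarrow>\<^sub>E UNIV) - {\<lambda>_\<in>{1..d}. Middle}"
    proof (intro equalityI subsetI)
      fix a assume "a \<in> (\<lambda>(K, \<rho>). full_pattern d K \<rho>) ` signed_sets d"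
      then obtain K \<rho> where K: "(K, \<rho>) \<in> signed_sets d" and a: "a = full_pattern d K \<rho>"
        by auto
      from full_pattern_neq_Middle[OF K] full_pattern_in show "a \<in> ({1..d} \<rightarrow>\<^sub>E UNIV) - {\<lambda>_\<in>{1..d}. Middle}"
        unfolding a by blast
    next
      fix a :: "nat \<Rightarrow> level"
      assume "a \<in> ({1..d} \<rightarrow>\<^sub>E UNIV) - {\<lambda>_\<in>{1..d}. Middle}"
      then have a: "a \<in> {1..d} \<rightarrow>\<^sub>E UNIV" "a \<noteq> (\<lambda>_\<in>{1..d}. Middle)" by auto
      let ?I = "{i \<in> {1..d}. a i \<noteq> Middle}"
      have fp: "full_pattern d ?I (restrict a ?I) = a"
        by (rule full_pattern_of_tail[OF a(1) refl])
      have "?I \<noteq> {}"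
      proof
        assume "?I = {}"
        have "a i = (\<lambda>_\<in>{1..d}. Middle) i" for i
          using PiE_arb[OF a(1), of i] \<open>?I = {}\<close> by (cases "i \<in> {1..d}") auto
        then have "a = (\<lambda>_\<in>{1..d}. Middle)" ..
        with a(2) show False ..
      qed
      then have "(?I, restrict a ?I) \<in> signed_sets d"
        by (intro tail_in_signed_sets) auto
      from imageI[OF this, of "\<lambda>(K, \<rho>). full_pattern d K \<rho>"] fp
      show "a \<in> (\<lambda>(K, \<rho>). full_pattern d K \<rho>) ` signed_sets d" by simp
    qed
  qed
  from sum.reindex_bij_betw[OF this, of f] show ?thesis
    by (simp add: case_prod_unfold)
qed

lemma extensions_singleton_eq:
  assumes "i \<in> {1..d}" "s \<in> sides"
  shows "extensions d {i} (\<lambda>_\<in>{i}. s) = {(K, \<rho>) \<in> signed_sets d. full_pattern d K \<rho> i = s}"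
  using assms by (auto simp: extensions_def full_pattern_def sides_def fun_eq_iff restrict_def)

text \<open>
  A single margin of a mixture sees only the letter at its coordinate, so weights are collected by
  that letter.
\<close>

lemma sum_signed_sets_by_letter:
  fixes f :: "nat set \<Rightarrow> (nat \<Rightarrow> level) \<Rightarrow> 'a :: comm_monoid_add"
  shows "(\<Sum>s\<in>UNIV. \<Sum>(I, \<sigma>)\<in>{(I, \<sigma>) \<in> signed_sets d. full_pattern d I \<sigma> i = s}. f I \<sigma>) =
    (\<Sum>(I, \<sigma>)\<in>signed_sets d. f I \<sigma>)"
proof -
  have "{(I, \<sigma>) \<in> signed_sets d. full_pattern d I \<sigma> i = s} =
      {x \<in> signed_sets d. (\<lambda>(I, \<sigma>). full_pattern d I \<sigma> i) x = s}" for s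
    by auto
  then show ?thesis
    by (simp only: sum.group[OF finite_signed_sets finite_UNIV_level subset_UNIV])
qed

section \<open>Cells and laws concentrated on one cell\<close>

lemma cell_measurable [measurable]: "cell p s \<in> sets borel"
  by (cases s) auto

definition cell_length :: "real \<Rightarrow> level \<Rightarrow> real" where
  "cell_length p s = (if s = Middle then 1 - 2 * p else p)"

lemma emeasure_cell:
  assumes "0 < p" "p < 1 / 2"
  shows "emeasure lborel (cell p s) = ennreal (cell_length p s)" "cell_length p s > 0"
  using assms by (cases s; simp add: cell_length_def)+

lemma cells_overlap:
  assumes "0 < p" "p < 1 / 2" "s \<noteq> t" "x \<in> cell p s" "x \<in> cell p t"
  shows "x = p \<or> x = 1 - p"
  using assms by (cases s; cases t) auto

lemma cells_cover:
  assumes "0 \<le> x" "x \<le> 1"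
  shows "\<exists>s. x \<in> cell p s"
proof -
  have "x \<in> cell p Lower \<or> x \<in> cell p Middle \<or> x \<in> cell p Upper"
    using assms by auto
  then show ?thesis by blast
qed

abbreviation cell_box :: "nat \<Rightarrow> real \<Rightarrow> (nat \<Rightarrow> level) \<Rightarrow> (nat \<Rightarrow> real) set" where
  "cell_box d p a \<equiv> \<Pi>\<^sub>E i\<in>{1..d}. cell p (a i)"

lemma box_measurable [measurable]: "cell_box d p a \<in> sets (Rn d)"
  by (intro sets_PiM_I_finite) auto

lemma coordinate_measurable:
  assumes "sets M = sets (Rn d)" "i \<in> {1..d}"
  shows "(\<lambda>x. x i) \<in> borel_measurable M"
  using assms measurable_component_singleton[of i "{1..d}" "\<lambda>_. borel"]
  by (simp cong: measurable_cong_sets)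

lemma AE_coordinates:
  assumes "sets M = sets (Rn d)"
    and "\<And>i. i \<in> {1..d} \<Longrightarrow> AE y in distr M borel (\<lambda>x. x i). P i y"
  shows "AE x in M. \<forall>i\<in>{1..d}. P i (x i)"
  using assms by (intro AE_finite_allI AE_distrD[OF coordinate_measurable]) auto

text \<open>
  The margins alone decide: they place each coordinate almost surely inside its interval, away from
  the two thresholds, and hence the whole vector inside one cell, whatever the dependence between
  the coordinates. For the witness components it is thus enough to compute margins.
\<close>

lemma emeasure_box_of_concentrated:
  assumes p: "0 < p" "p < 1 / 2"
    and M: "prob_space M" "sets M = sets (Rn d)"
    and margins: "\<And>i. i \<in> {1..d} \<Longrightarrow>
      distr M borel (\<lambda>x. x i) = uniform_measure lborel (cell p (b i))"
    and ab: "a \<in> {1..d} \<rightarrow>\<^sub>E UNIV" "b \<in> {1..d} \<rightarrow>\<^sub>E UNIV"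
  shows "emeasure M (cell_box d p a) = (if a = b then 1 else 0)"
proof -
  interpret prob_space M by (rule M)
  have "AE y in uniform_measure lborel (cell p s). y \<in> cell p s \<and> y \<noteq> p \<and> y \<noteq> 1 - p" for s
    using AE_lborel_singleton[of p] AE_lborel_singleton[of "1 - p"]
    by (subst AE_uniform_measure) (use emeasure_cell[OF p, of s] in auto)
  then have AE: "AE x in M. \<forall>i\<in>{1..d}. x i \<in> cell p (b i) \<and> x i \<noteq> p \<and> x i \<noteq> 1 - p"
    by (intro AE_coordinates M) (simp only: margins)
  have box[measurable]: "cell_box d p c \<in> sets M" for c
    unfolding M(2) by (rule box_measurable)
  show ?thesis
  proof (cases "a = b")
    case True
    have "AE x in M. x \<in> cell_box d p a"
      using AE AE_space by eventually_elim
        (use True sets_eq_imp_space_eq[OF M(2)] in \<open>auto simp: space_PiM PiE_iff\<close>)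
    then show ?thesis using True emeasure_eq_1_AE[OF box] by simp
  next
    case False
    then obtain i where i: "i \<in> {1..d}" "a i \<noteq> b i"
      using ab by (metis PiE_ext)
    have "AE x in M. x \<notin> cell_box d p a"
      using AE
    proof eventually_elim
      case (elim x)
      show ?case
      proof
        assume "x \<in> cell_box d p a"
        from PiE_mem[OF this i(1)] elim i(1) cells_overlap[OF p i(2), of "x i"] show False
          by simp
      qed
    qed
    then have "emeasure M (cell_box d p a) = emeasure M {}"
      by (intro emeasure_eq_AE[OF _ box sets.empty_sets]) simp
    then show ?thesis using False by simp
  qed
qed

section \<open>Margins of the witness components\<close>

text \<open>
  Lebesgue measure scales by the constant \<open>\<bar>c\<bar>\<close> under the map, and the constant cancels in the
  normalisation of the uniform law.
\<close>

lemma distr_uniform01_affine: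
  fixes c t :: real
  assumes c: "c \<noteq> 0"
  shows "distr uniform01 borel (\<lambda>x. t + c * x) = uniform_measure lborel ((\<lambda>x. t + c * x) ` {0..1})"
    (is "distr _ _ ?f = uniform_measure _ ?S")
proof (rule measure_eqI)
  have S[measurable]: "?S \<in> sets borel"
    by (intro borel_compact compact_continuous_image continuous_intros) auto
  have scale: "emeasure lborel X = ennreal \<bar>c\<bar> * emeasure lborel (?f -` X)"
    if [measurable]: "X \<in> sets borel" for X
    by (subst lborel_real_affine[OF c, of t])
      (simp add: emeasure_density nn_integral_cmult_indicator emeasure_distr)
  have vS: "?f -` ?S = {0..1}"
    using c by (intro inj_vimage_image_eq injI) auto
  have cancel: "ennreal \<bar>c\<bar> * x / ennreal \<bar>c\<bar> = x" for x
    using c by (subst mult.commute) (intro ennreal_mult_divide_eq, auto)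
  fix X assume "X \<in> sets (distr uniform01 borel ?f)"
  then have X[measurable]: "X \<in> sets borel" by simp
  have "emeasure (uniform_measure lborel ?S) X = emeasure lborel (?S \<inter> X) / emeasure lborel ?S"
    by simp
  also have "\<dots> = emeasure lborel ({0..1} \<inter> ?f -` X)"
    unfolding scale[OF S] scale[OF sets.Int[OF S X]] vimage_Int vS by (simp add: cancel)
  also have "\<dots> = emeasure (distr uniform01 borel ?f) X"
  proof -
    have "?f -` X \<in> sets borel"
      using measurable_sets_borel[of ?f borel X] by simp
    then show ?thesis by (simp add: emeasure_distr divide_ennreal_def)
  qed
  finally show "emeasure (distr uniform01 borel ?f) X = emeasure (uniform_measure lborel ?S) X" ..
qed simp

lemma cell_eq_affine_image:
  assumes "0 < p" "p < 1 / 2"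
  shows "cell p Lower = (\<lambda>x. 0 + p * x) ` {0..1}"
    and "cell p Middle = (\<lambda>x. p + (1 - 2 * p) * x) ` {0..1}"
    and "cell p Upper = (\<lambda>x. 1 + (- p) * x) ` {0..1}"
  using assms image_affinity_atLeastAtMost[of p 0 0 1]
    image_affinity_atLeastAtMost[of "1 - 2 * p" p 0 1]
    image_affinity_atLeastAtMost[of "- p" 1 0 1]
  by (simp_all add: add.commute)

lemma prob_space_uniform01: "prob_space uniform01"
  by (intro prob_space_uniform_measure) auto

lemma prob_space_uniform01_power: "prob_space (PiM {1..d} (\<lambda>_. uniform01))"
  by (intro prob_space_PiM prob_space_uniform01)

lemma distr_pair_snd:
  assumes "prob_space M" "sigma_finite_measure N"
  shows "distr (M \<Otimes>\<^sub>M N) N snd = N"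
proof (rule measure_eqI)
  interpret M: prob_space M by (rule assms)
  interpret N: sigma_finite_measure N by (rule assms)
  fix A assume "A \<in> sets (distr (M \<Otimes>\<^sub>M N) N snd)"
  then have A: "A \<in> sets N" by simp
  then have "snd -` A \<inter> space (M \<Otimes>\<^sub>M N) = space M \<times> A"
    using sets.sets_into_space by (auto simp: space_pair_measure)
  with A show "emeasure (distr (M \<Otimes>\<^sub>M N) N snd) A = emeasure N A"
    by (simp add: emeasure_distr N.emeasure_pair_measure_Times M.emeasure_space_1)
qed simp

lemma witness_map_measurable [measurable]:
  "(\<lambda>(z, v). \<lambda>i\<in>{1..d}.
      if i \<in> I then (if \<sigma> i = Lower then p * z else 1 - p * z) else p + (1 - 2 * p) * v i)
    \<in> (uniform01 \<Otimes>\<^sub>M PiM {1..d} (\<lambda>_. uniform01)) \<rightarrow>\<^sub>M Rn d"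
proof -
  have "(\<lambda>w. \<lambda>i\<in>{1..d}.
      if i \<in> I then (if \<sigma> i = Lower then p * fst w else 1 - p * fst w) else p + (1 - 2 * p) * snd w i)
    \<in> (uniform01 \<Otimes>\<^sub>M PiM {1..d} (\<lambda>_. uniform01)) \<rightarrow>\<^sub>M Rn d"
  proof (rule measurable_restrict)
    fix i assume i: "i \<in> {1..d}"
    have c: "(\<lambda>v. v i) \<in> PiM {1..d} (\<lambda>_. uniform01) \<rightarrow>\<^sub>M borel"
      using measurable_component_singleton[OF i, of "\<lambda>_. uniform01"] by (simp cong: measurable_cong_sets)
    have [measurable]: "(\<lambda>w. snd w i) \<in> borel_measurable (uniform01 \<Otimes>\<^sub>M PiM {1..d} (\<lambda>_. uniform01))"
      by (rule measurable_compose[OF measurable_snd c])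
    have "(fst :: real \<times> (nat \<Rightarrow> real) \<Rightarrow> real) \<in> uniform01 \<Otimes>\<^sub>M PiM {1..d} (\<lambda>_. uniform01) \<rightarrow>\<^sub>M uniform01"
      by (rule measurable_fst)
    then have [measurable]: "(fst :: real \<times> (nat \<Rightarrow> real) \<Rightarrow> real) \<in> borel_measurable (uniform01 \<Otimes>\<^sub>M PiM {1..d} (\<lambda>_. uniform01))"
      by (simp cong: measurable_cong_sets)
    show "(\<lambda>w. if i \<in> I then (if \<sigma> i = Lower then p * fst w else 1 - p * fst w) else p + (1 - 2 * p) * snd w i)
      \<in> (uniform01 \<Otimes>\<^sub>M PiM {1..d} (\<lambda>_. uniform01)) \<rightarrow>\<^sub>M borel"
      by measurable
  qed
  then show ?thesis by (simp add: case_prod_unfold)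
qed

lemma sets_witness_component [simp]: "sets (witness_component d p I \<sigma>) = sets (Rn d)"
  by (simp add: witness_component_def)

lemma prob_space_witness_component: "prob_space (witness_component d p I \<sigma>)"
proof -
  interpret U: prob_space uniform01 by (rule prob_space_uniform01)
  interpret V: prob_space "PiM {1..d} (\<lambda>_. uniform01)" by (rule prob_space_uniform01_power)
  interpret P: pair_prob_space uniform01 "PiM {1..d} (\<lambda>_. uniform01)" ..
  show ?thesis
    unfolding witness_component_def by (rule P.prob_space_distr[OF witness_map_measurable])
qed

text \<open>
  With no index in the tail, the shared variable \<open>Z\<close> does not enter the vector and integrates out,
  so results on components cover the base law as well.
\<close>

lemma witness_base_eq_component: "witness_base d p = witness_component d p {} \<sigma>"
proof -
  interpret U: prob_space uniform01 by (rule prob_space_uniform01)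
  let ?V = "PiM {1..d} (\<lambda>_. uniform01)"
  interpret V: prob_space ?V by (rule prob_space_uniform01_power)
  have snd: "distr (uniform01 \<Otimes>\<^sub>M ?V) ?V snd = ?V"
    by (intro distr_pair_snd) (unfold_locales)
  have "(\<lambda>v. \<lambda>i\<in>{1..d}. p + (1 - 2 * p) * v i) \<in> ?V \<rightarrow>\<^sub>M Rn d"
  proof (rule measurable_restrict)
    fix i assume i: "i \<in> {1..d}"
    have [measurable]: "(\<lambda>v. v i) \<in> borel_measurable ?V"
      using measurable_component_singleton[OF i, of "\<lambda>_. uniform01"] by (simp cong: measurable_cong_sets)
    show "(\<lambda>v. p + (1 - 2 * p) * v i) \<in> borel_measurable ?V" by measurable
  qed
  then show ?thesis
    unfolding witness_base_def witness_component_def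
    by (subst snd[symmetric], subst distr_distr) (auto simp: comp_def case_prod_unfold)
qed

text \<open>
  Each coordinate of a component is an affine function of one uniform variable, \<open>Z\<close> on \<open>I\<close> and \<open>V\<^sub>i\<close>
  elsewhere, and the affine maps are those that carry the unit interval onto the cell intervals.
\<close>

lemma witness_component_margin:
  assumes p: "0 < p" "p < 1 / 2"
    and I: "\<And>j. j \<in> I \<Longrightarrow> \<sigma> j \<in> sides" and i: "i \<in> {1..d}"
  shows "distr (witness_component d p I \<sigma>) borel (\<lambda>x. x i) =
    uniform_measure lborel (cell p (full_pattern d I \<sigma> i))"
proof -
  interpret U: prob_space uniform01 by (rule prob_space_uniform01)
  let ?V = "PiM {1..d} (\<lambda>_. uniform01)" and ?P = "uniform01 \<Otimes>\<^sub>M PiM {1..d} (\<lambda>_. uniform01)"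
  interpret V: prob_space ?V by (rule prob_space_uniform01_power)
  have "distr (witness_component d p I \<sigma>) borel (\<lambda>x. x i) =
      distr ?P borel (\<lambda>w. if i \<in> I then (if \<sigma> i = Lower then p * fst w else 1 - p * fst w)
        else p + (1 - 2 * p) * snd w i)"
    unfolding witness_component_def using i
    by (subst distr_distr) (auto simp: comp_def case_prod_unfold intro!: distr_cong)
  also have "\<dots> = uniform_measure lborel (cell p (full_pattern d I \<sigma> i))"
  proof (cases "i \<in> I")
    case True
    have fst: "distr ?P borel (\<lambda>w. t + c * fst w) = distr uniform01 borel (\<lambda>x. t + c * x)" for t c :: real
      by (subst V.distr_pair_fst[of uniform01, symmetric], subst distr_distr) (auto simp: comp_def)
    from I[OF True] consider "\<sigma> i = Lower" | "\<sigma> i = Upper"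
      by (auto simp: sides_def)
    then show ?thesis
    proof cases
      case 1
      with True i fst[of 0 p] p show ?thesis
        using distr_uniform01_affine[of p 0] cell_eq_affine_image(1)[OF p]
        by (simp add: full_pattern_def)
    next
      case 2
      with True i fst[of 1 "- p"] p show ?thesis
        using distr_uniform01_affine[of "- p" 1] cell_eq_affine_image(3)[OF p]
        by (simp add: full_pattern_def)
    qed
  next
    case False
    have c: "distr ?V uniform01 (\<lambda>v. v i) = uniform01"
      using i by (intro distr_PiM_component prob_space_uniform01)
    have s: "distr ?P ?V snd = ?V"
      by (intro distr_pair_snd) (unfold_locales)
    have ci: "(\<lambda>v. v i) \<in> ?V \<rightarrow>\<^sub>M uniform01"
      using i by (rule measurable_component_singleton)
    have "distr ?P borel (\<lambda>w. p + (1 - 2 * p) * snd w i) = distr uniform01 borel (\<lambda>x. p + (1 - 2 * p) * x)"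
    proof -
      have "distr ?P uniform01 (\<lambda>w. snd w i) = distr (distr ?P ?V snd) uniform01 (\<lambda>v. v i)"
        by (subst distr_distr[OF ci measurable_snd]) (simp add: comp_def)
      also have "\<dots> = uniform01" unfolding s by (rule c)
      finally have "distr uniform01 borel (\<lambda>x. p + (1 - 2 * p) * x) =
          distr (distr ?P uniform01 (\<lambda>w. snd w i)) borel (\<lambda>x. p + (1 - 2 * p) * x)"
        by simp
      also have "\<dots> = distr ?P borel (\<lambda>w. p + (1 - 2 * p) * snd w i)"
        by (subst distr_distr[OF _ measurable_compose[OF measurable_snd ci]]) (auto simp: comp_def)
      finally show ?thesis ..
    qed
    with False i p show ?thesis
      using distr_uniform01_affine[of "1 - 2 * p" p] cell_eq_affine_image(2)[OF p]
      by (simp add: full_pattern_def)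
  qed
  finally show ?thesis .
qed

section \<open>The threshold partition of a copula law\<close>

lemma copula_law_sets:
  assumes "copula_law d M"
  shows "sets M = sets (Rn d)" "prob_space M"
    "i \<in> {1..d} \<Longrightarrow> distr M borel (\<lambda>x. x i) = uniform01"
  using assms by (auto simp: copula_law_def uniform_margins_def)

text \<open>
  Adjacent closed cells meet only where a coordinate equals a threshold, which has probability zero
  because margins have no atoms.
\<close>

lemma copula_law_AE_boundary:
  assumes "copula_law d M"
  shows "AE x in M. \<forall>i\<in>{1..d}. 0 \<le> x i \<and> x i \<le> 1 \<and> x i \<noteq> p \<and> x i \<noteq> 1 - p"
proof -
  have "AE y in uniform01. 0 \<le> y \<and> y \<le> 1 \<and> y \<noteq> p \<and> y \<noteq> 1 - p"
    using AE_lborel_singleton[of p] AE_lborel_singleton[of "1 - p"]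
    by (subst AE_uniform_measure) auto
  then show ?thesis
    by (intro AE_coordinates copula_law_sets(1)[OF assms])
      (simp only: copula_law_sets(3)[OF assms])
qed

lemma sum_measure_boxes:
  assumes p: "0 < p" "p < 1 / 2" and M: "copula_law d M"
    and S: "S \<subseteq> {1..d} \<rightarrow>\<^sub>E UNIV"
  shows "(\<Sum>a\<in>S. measure M (cell_box d p a)) = measure M (\<Union>a\<in>S. cell_box d p a)"
proof -
  interpret prob_space M by (rule copula_law_sets(2)[OF M])
  have fin: "finite S"
    by (rule finite_subset[OF S finite_patterns])
  have box: "cell_box d p a \<in> fmeasurable M" for a
  proof -
    have "cell_box d p a \<in> sets M"
      unfolding copula_law_sets(1)[OF M] by (rule box_measurable)
    then show ?thesis by (intro fmeasurableI) (simp_all add: less_top[symmetric])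
  qed
  have null: "AE x in M. x \<notin> cell_box d p a \<or> x \<notin> cell_box d p b"
    if "a \<in> S" "b \<in> S" "a \<noteq> b" for a b
  proof -
    from that S obtain i where i: "i \<in> {1..d}" "a i \<noteq> b i"
      by (meson PiE_ext subsetD)
    show ?thesis
      using copula_law_AE_boundary[OF M, of p]
    proof eventually_elim
      case (elim x)
      show ?case
      proof (rule ccontr)
        assume "\<not> (x \<notin> cell_box d p a \<or> x \<notin> cell_box d p b)"
        then have "x \<in> cell_box d p a" "x \<in> cell_box d p b" by auto
        from PiE_mem[OF this(1) i(1)] PiE_mem[OF this(2) i(1)] elim i(1)
          cells_overlap[OF p i(2), of "x i"]
        show False by simp
      qed
    qed
  qed
  show ?thesis
    by (intro measure_UNION_AE[symmetric] fin box pairwiseI null)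
qed

lemma sum_measure_all_boxes:
  assumes p: "0 < p" "p < 1 / 2" and M: "copula_law d M"
  shows "(\<Sum>a\<in>{1..d} \<rightarrow>\<^sub>E UNIV. measure M (cell_box d p a)) \<le> 1"
  unfolding sum_measure_boxes[OF p M subset_refl]
  by (rule prob_space.prob_le_1[OF copula_law_sets(2)[OF M]])

text \<open>
  Up to null sets, the cells with letter \<open>s\<close> at \<open>i\<close> make up the event that the \<open>i\<close>-th coordinate
  lies in its outer interval, and that event has probability \<open>p\<close> by uniformity of the margin.
\<close>

lemma sum_measure_boxes_coordinate:
  assumes p: "0 < p" "p < 1 / 2" and M: "copula_law d M"
    and i: "i \<in> {1..d}" and s: "s \<in> sides"
  shows "(\<Sum>a\<in>{a \<in> {1..d} \<rightarrow>\<^sub>E UNIV. restrict a {i} = (\<lambda>_\<in>{i}. s)}. measure M (cell_box d p a)) = p"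
    (is "sum _ ?S = p")
proof -
  note setsM = copula_law_sets(1)[OF M]
  have S: "?S = {a \<in> {1..d} \<rightarrow>\<^sub>E UNIV. a i = s}"
    by (auto simp: restrict_def fun_eq_iff)
  have mi[measurable]: "(\<lambda>x. x i) \<in> borel_measurable M"
    by (rule coordinate_measurable[OF setsM i])
  have "(\<Sum>a\<in>?S. measure M (cell_box d p a)) = measure M (\<Union>a\<in>?S. cell_box d p a)"
    by (rule sum_measure_boxes[OF p M]) auto
  also have "\<dots> = measure M ((\<lambda>x. x i) -` cell p s \<inter> space M)"
  proof (rule measure_eq_AE)
    show "AE x in M. x \<in> (\<Union>a\<in>?S. cell_box d p a) \<longleftrightarrow> x \<in> (\<lambda>x. x i) -` cell p s \<inter> space M"
      using copula_law_AE[OF M] AE_space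
    proof eventually_elim
      fix x assume x: "\<forall>i\<in>{1..d}. 0 \<le> x i \<and> x i \<le> 1" and sp: "x \<in> space M"
      then have ext: "x \<in> extensional {1..d}"
        using sets_eq_imp_space_eq[OF setsM] by (auto simp: space_PiM PiE_iff)
      have "x \<in> (\<Union>a\<in>?S. cell_box d p a)" if xi: "x i \<in> cell p s"
      proof -
        have "\<forall>j\<in>{1..d}. \<exists>t. x j \<in> cell p t"
          using x cells_cover by blast
        then obtain t where t: "\<forall>j\<in>{1..d}. x j \<in> cell p (t j)"
          by metis
        let ?a = "\<lambda>j\<in>{1..d}. if j = i then s else t j"
        have "?a \<in> ?S" using i unfolding S by auto
        moreover have "x \<in> cell_box d p ?a"
          using t xi ext by (auto simp: PiE_iff)
        ultimately show ?thesis by blast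
      qed
      moreover have "x i \<in> cell p s" if "x \<in> (\<Union>a\<in>?S. cell_box d p a)"
      proof -
        from that obtain a where a: "a i = s" "x \<in> cell_box d p a"
          unfolding S by blast
        from PiE_mem[OF a(2) i] a(1) show ?thesis by simp
      qed
      ultimately show "x \<in> (\<Union>a\<in>?S. cell_box d p a) \<longleftrightarrow> x \<in> (\<lambda>x. x i) -` cell p s \<inter> space M"
        using sp by auto
    qed
    have "finite ?S" by (rule finite_subset[OF _ finite_patterns[of d]]) auto
    then show "(\<Union>a\<in>?S. cell_box d p a) \<in> sets M"
      unfolding setsM using box_measurable by (intro sets.finite_UN) auto
    show "(\<lambda>x. x i) -` cell p s \<inter> space M \<in> sets M"
      by measurable
  qed
  also have "\<dots> = measure (distr M borel (\<lambda>x. x i)) (cell p s)"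
    by (simp add: measure_distr)
  also have "\<dots> = measure uniform01 (cell p s)"
    unfolding copula_law_sets(3)[OF M i] ..
  also have "\<dots> = p"
  proof -
    have "{0..1} \<inter> cell p s = cell p s" using p s by (auto simp: sides_def)
    then have "emeasure uniform01 (cell p s) = ennreal p"
      using emeasure_cell(1)[OF p, of s] s
      by (auto simp: cell_length_def sides_def divide_ennreal_def)
    then show ?thesis using p by (simp add: measure_def)
  qed
  finally show ?thesis .
qed

section \<open>Necessity of the conditions\<close>

lemma tail_family_eq_sum_extensions:
  assumes "(J, \<tau>) \<in> signed_sets d"
  shows "tail_family d p C J \<tau> =
    (\<Sum>(K, \<rho>)\<in>extensions d J \<tau>. cell_prob d p C (full_pattern d K \<rho>) / p)"
  unfolding tail_family_def sum_patterns_eq_sum_extensions[OF assms]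
  by (simp add: sum_distrib_left case_prod_unfold)

text \<open>
  The recovered coefficients are rescaled cell probabilities. Nonnegativity and the bound on their
  sum are then instances of positivity and total mass one.
\<close>

lemma triangular_inversion_of_tail_family:
  assumes "has_tail_family d p C lam" "(I, \<sigma>) \<in> signed_sets d"
  shows "triangular_inversion d lam I \<sigma> = cell_prob d p C (full_pattern d I \<sigma>) / p"
  using assms(1)
  by (intro triangular_inversion_unique[OF _ assms(2)])
    (auto simp: has_tail_family_def tail_family_eq_sum_extensions[symmetric])

lemma copula_tail_family_conditions:
  assumes p: "0 < p" "p < 1 / 2" and C: "copula d C" and lam: "has_tail_family d p C lam"
  shows "\<And>I \<sigma>. (I, \<sigma>) \<in> signed_sets d \<Longrightarrow> triangular_inversion d lam I \<sigma> \<ge> 0"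
    and "\<And>i s. i \<in> {1..d} \<Longrightarrow> s \<in> sides \<Longrightarrow> lam {i} (\<lambda>_\<in>{i}. s) = 1"
    and "p * (\<Sum>(I, \<sigma>)\<in>signed_sets d. triangular_inversion d lam I \<sigma>) \<le> 1"
proof -
  from C obtain M where M: "copula_law d M" and "has_df d M C"
    by (auto simp: copula_def)
  then have q: "cell_prob d p C a = measure M (cell_box d p a)" for a
    unfolding cell_prob_def by (simp add: law_of_eq)
  show "triangular_inversion d lam I \<sigma> \<ge> 0" if "(I, \<sigma>) \<in> signed_sets d" for I \<sigma>
    unfolding triangular_inversion_of_tail_family[OF lam that] q using p by simp
  show "lam {i} (\<lambda>_\<in>{i}. s) = 1" if "i \<in> {1..d}" "s \<in> sides" for i s
  proof -
    have "lam {i} (\<lambda>_\<in>{i}. s) = tail_family d p C {i} (\<lambda>_\<in>{i}. s)"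
      using lam singleton_signed_set[OF that] by (auto simp: has_tail_family_def)
    also have "\<dots> = 1"
      using p unfolding tail_family_def q sum_measure_boxes_coordinate[OF p M that] by simp
    finally show ?thesis .
  qed
  have "p * (\<Sum>(I, \<sigma>)\<in>signed_sets d. triangular_inversion d lam I \<sigma>) =
      (\<Sum>(I, \<sigma>)\<in>signed_sets d. measure M (cell_box d p (full_pattern d I \<sigma>)))"
    using p unfolding sum_distrib_left
    by (intro sum.cong) (auto simp: triangular_inversion_of_tail_family[OF lam] q)
  also have "\<dots> = (\<Sum>a\<in>({1..d} \<rightarrow>\<^sub>E UNIV) - {\<lambda>_\<in>{1..d}. Middle}. measure M (cell_box d p a))"
    by (rule sum_signed_sets_eq_sum_patterns)
  also have "\<dots> \<le> (\<Sum>a\<in>({1..d} \<rightarrow>\<^sub>E UNIV). measure M (cell_box d p a))"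
    by (intro sum_mono2 finite_patterns) auto
  also have "\<dots> \<le> 1"
    by (rule sum_measure_all_boxes[OF p M])
  finally show "p * (\<Sum>(I, \<sigma>)\<in>signed_sets d. triangular_inversion d lam I \<sigma>) \<le> 1" .
qed

section \<open>The geometric witness\<close>

lemma sets_witness_law [simp]: "sets (witness_law d p v) = sets (Rn d)"
  unfolding witness_law_def using sets.space_closed[of "Rn d"]
  by (simp add: sets.sigma_sets_eq)

text \<open>
  Total mass one follows from the uniformity of any one margin; \<open>d \<ge> 1\<close> supplies such a margin.
\<close>

lemma copula_law_witness_law:
  assumes "d \<ge> 1" "uniform_margins d (witness_law d p v)"
  shows "copula_law d (witness_law d p v)"
proof -
  let ?M = "witness_law d p v"
  have "distr ?M borel (\<lambda>x. x 1) = uniform01"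
    using assms by (auto simp: uniform_margins_def)
  moreover have "(\<lambda>x. x 1) \<in> borel_measurable ?M"
    using assms(1) by (intro coordinate_measurable[of _ d]) auto
  ultimately have "prob_space ?M"
    using prob_space_distrD prob_space_uniform01 by metis
  then show ?thesis
    using assms(2) by (simp add: copula_law_def)
qed

lemma geometric_witness_copula_is_copula:
  assumes "d \<ge> 1" "geometric_witness_copula d p C"
  shows "copula d C"
  using assms copula_law_witness_law
  unfolding geometric_witness_copula_def copula_def by blast

text \<open>
  Different signed sets select different cells, and the base law selects the central one, so exactly
  one component of the mixture charges a given non-central cell.
\<close>

lemma measure_witness_law_box:
  assumes p: "0 < p" "p < 1 / 2"
    and v: "\<And>I \<sigma>. (I, \<sigma>) \<in> signed_sets d \<Longrightarrow> v I \<sigma> \<ge> 0"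
    and K: "(K, \<rho>) \<in> signed_sets d"
  shows "measure (witness_law d p v) (cell_box d p (full_pattern d K \<rho>)) = p * v K \<rho>"
proof -
  have component: "emeasure (witness_component d p I \<sigma>) (cell_box d p (full_pattern d K \<rho>)) =
      (if full_pattern d K \<rho> = full_pattern d I \<sigma> then 1 else 0)"
    if "\<And>j. j \<in> I \<Longrightarrow> \<sigma> j \<in> sides" for I \<sigma>
    by (intro emeasure_box_of_concentrated[OF p] prob_space_witness_component
        sets_witness_component witness_component_margin[OF p that] full_pattern_in)
  from component[of "{}" "\<lambda>_. undefined"] have base:
    "emeasure (witness_base d p) (cell_box d p (full_pattern d K \<rho>)) = 0"
    using full_pattern_neq_Middle[OF K]
    unfolding witness_base_eq_component[of d p "\<lambda>_. undefined"] full_pattern_empty by simp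
  have "emeasure (witness_component d p I \<sigma>) (cell_box d p (full_pattern d K \<rho>)) =
      (if (I, \<sigma>) = (K, \<rho>) then 1 else 0)" if I: "(I, \<sigma>) \<in> signed_sets d" for I \<sigma>
  proof -
    have "\<sigma> j \<in> sides" if "j \<in> I" for j
      using I that by (auto simp: signed_sets_def)
    from component[OF this] full_pattern_inj[OF K I] show ?thesis by auto
  qed
  then have "emeasure (witness_law d p v) (cell_box d p (full_pattern d K \<rho>)) =
      (\<Sum>x\<in>signed_sets d. if x = (K, \<rho>) then ennreal (p * v K \<rho>) else 0)"
    unfolding emeasure_witness_law[OF box_measurable] base
    by (auto intro!: sum.cong)
  also have "\<dots> = ennreal (p * v K \<rho>)"
    using K finite_signed_sets by simp
  finally show ?thesis
    using v[OF K] p by (simp add: measure_def)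
qed

text \<open>
  The law of total probability for a uniform variable split at the two thresholds.
\<close>

lemma uniform01_eq_cell_mixture:
  assumes p: "0 < p" "p < 1 / 2" and A: "A \<in> sets borel"
  shows "(\<Sum>s\<in>UNIV. ennreal (cell_length p s) * emeasure (uniform_measure lborel (cell p s)) A)
    = emeasure uniform01 A"
proof -
  have U: "ennreal (cell_length p s) * emeasure (uniform_measure lborel (cell p s)) A
      = emeasure lborel (cell p s \<inter> A)" for s
  proof -
    have "ennreal (cell_length p s) * emeasure (uniform_measure lborel (cell p s)) A
        = emeasure lborel (cell p s \<inter> A) * ennreal (cell_length p s) / ennreal (cell_length p s)"
      using A by (simp add: emeasure_cell(1)[OF p] ennreal_times_divide mult.commute)
    also have "\<dots> = emeasure lborel (cell p s \<inter> A)"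
      using emeasure_cell(2)[OF p, of s] by (intro ennreal_mult_divide_eq) auto
    finally show ?thesis .
  qed
  \<comment> \<open>The closed intervals share the thresholds; dropping these null points makes them disjoint.\<close>
  have L: "emeasure lborel (cell p Lower \<inter> A) = emeasure lborel ({0..<p} \<inter> A)"
    using A AE_lborel_singleton[of p] by (intro emeasure_eq_AE) (auto elim!: eventually_mono)
  have R: "emeasure lborel (cell p Upper \<inter> A) = emeasure lborel ({1-p<..1} \<inter> A)"
    using A AE_lborel_singleton[of "1 - p"] by (intro emeasure_eq_AE) (auto elim!: eventually_mono)
  have "emeasure lborel ({0..<p} \<inter> A) + (emeasure lborel ({p..1-p} \<inter> A) + emeasure lborel ({1-p<..1} \<inter> A))
      = emeasure lborel ({0..<p} \<inter> A) + emeasure lborel (({p..1-p} \<inter> A) \<union> ({1-p<..1} \<inter> A))"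
    using A by (subst plus_emeasure) auto
  also have "\<dots> = emeasure lborel (({0..<p} \<inter> A) \<union> (({p..1-p} \<inter> A) \<union> ({1-p<..1} \<inter> A)))"
    using A p by (intro plus_emeasure) auto
  also have "({0..<p} \<inter> A) \<union> (({p..1-p} \<inter> A) \<union> ({1-p<..1} \<inter> A)) = {0..1} \<inter> A"
    using p by auto
  finally show ?thesis
    using A unfolding U UNIV_level by (simp add: L[simplified] R[simplified] add.assoc divide_ennreal_def)
qed

text \<open>
  The \<open>i\<close>-th margin is a mixture of the uniform laws on the three intervals. The hypothesis on sums
  over extensions gives the two outer intervals weight \<open>p\<close> each; as all weights add up to one,
  \<open>1 - 2 * p\<close> remains for the middle interval. These are the interval lengths.
\<close>

lemma uniform_margins_witness_law:
  assumes p: "0 < p" "p < 1 / 2"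
    and v: "\<And>I \<sigma>. (I, \<sigma>) \<in> signed_sets d \<Longrightarrow> v I \<sigma> \<ge> 0" and base: "base_mass d p v \<ge> 0"
    and one: "\<And>i s. i \<in> {1..d} \<Longrightarrow> s \<in> sides \<Longrightarrow>
      (\<Sum>(K, \<rho>)\<in>extensions d {i} (\<lambda>_\<in>{i}. s). v K \<rho>) = 1"
  shows "uniform_margins d (witness_law d p v)"
  unfolding uniform_margins_def
proof
  fix i assume i: "i \<in> {1..d}"
  let ?M = "witness_law d p v"
  \<comment> \<open>The mass that the tail components put on the interval of letter \<open>s\<close>; the base law adds to the
    middle interval only.\<close>
  define W where "W s =
    (\<Sum>(I, \<sigma>)\<in>{(I, \<sigma>) \<in> signed_sets d. full_pattern d I \<sigma> i = s}. p * v I \<sigma>)" for s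
  have side: "W s = p" if "s \<in> sides" for s
    using one[OF i that] unfolding W_def extensions_singleton_eq[OF i that]
    by (simp add: sum_distrib_left[symmetric] case_prod_unfold)
  have "(\<Sum>s\<in>UNIV. W s) = (\<Sum>(I, \<sigma>)\<in>signed_sets d. p * v I \<sigma>)"
    unfolding W_def by (rule sum_signed_sets_by_letter)
  also have "\<dots> = 1 - base_mass d p v"
    by (simp add: base_mass_def sum_distrib_left case_prod_unfold)
  finally have middle: "base_mass d p v + W Middle = 1 - 2 * p"
    using side[of Lower] side[of Upper] by (simp add: UNIV_level sides_def)
  have W0: "W s \<ge> 0" for s
    unfolding W_def using v p by (intro sum_nonneg) auto
  have mi: "(\<lambda>x. x i) \<in> borel_measurable N" if "sets N = sets (Rn d)" for N
    using coordinate_measurable[OF that i] .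
  show "distr ?M borel (\<lambda>x. x i) = uniform01"
  proof (rule measure_eqI)
    fix A assume "A \<in> sets (distr ?M borel (\<lambda>x. x i))"
    then have A[measurable]: "A \<in> sets borel" by simp
    let ?X = "(\<lambda>x. x i) -` A \<inter> space (Rn d)"
    have X: "?X \<in> sets (Rn d)"
      using measurable_sets[OF mi[OF refl] A] .
    define u where "u s = emeasure (uniform_measure lborel (cell p s)) A" for s
    have comp: "emeasure (witness_component d p I \<sigma>) ?X = u (full_pattern d I \<sigma> i)"
      if "\<And>j. j \<in> I \<Longrightarrow> \<sigma> j \<in> sides" for I \<sigma>
    proof -
      have "u (full_pattern d I \<sigma> i) = emeasure (distr (witness_component d p I \<sigma>) borel (\<lambda>x. x i)) A"
        unfolding u_def by (subst witness_component_margin[OF p _ i]) (simp_all add: that)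
      also have "\<dots> = emeasure (witness_component d p I \<sigma>) ?X"
        by (subst emeasure_distr[OF mi A])
          (simp_all only: sets_witness_component sets_eq_imp_space_eq[OF sets_witness_component])
      finally show ?thesis ..
    qed
    have "emeasure (distr ?M borel (\<lambda>x. x i)) A = emeasure ?M ?X"
      by (subst emeasure_distr[OF mi A])
        (simp_all only: sets_witness_law sets_eq_imp_space_eq[OF sets_witness_law])
    also have "\<dots> = ennreal (base_mass d p v) * u Middle +
        (\<Sum>(I, \<sigma>)\<in>signed_sets d. ennreal (p * v I \<sigma>) * u (full_pattern d I \<sigma> i))"
    proof -
      have "emeasure (witness_base d p) ?X = u Middle"
        using comp[of "{}" "\<lambda>_. undefined"] i
        unfolding witness_base_eq_component[of d p "\<lambda>_. undefined"]
        by (simp add: full_pattern_empty)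
      moreover have "emeasure (witness_component d p I \<sigma>) ?X = u (full_pattern d I \<sigma> i)"
        if I: "(I, \<sigma>) \<in> signed_sets d" for I \<sigma>
        using I by (intro comp) (auto simp: signed_sets_def)
      ultimately show ?thesis
        unfolding emeasure_witness_law[OF X] by (auto intro!: arg_cong2[where f = "(+)"] sum.cong)
    qed
    also have "(\<Sum>(I, \<sigma>)\<in>signed_sets d. ennreal (p * v I \<sigma>) * u (full_pattern d I \<sigma> i)) =
        (\<Sum>s\<in>UNIV. \<Sum>(I, \<sigma>)\<in>{(I, \<sigma>) \<in> signed_sets d. full_pattern d I \<sigma> i = s}.
          ennreal (p * v I \<sigma>) * u (full_pattern d I \<sigma> i))"
      by (rule sum_signed_sets_by_letter[symmetric])
    also have "\<dots> = (\<Sum>s\<in>UNIV. ennreal (W s) * u s)"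
    proof (rule sum.cong[OF refl])
      fix s
      let ?T = "{(I, \<sigma>) \<in> signed_sets d. full_pattern d I \<sigma> i = s}"
      have "(\<Sum>(I, \<sigma>)\<in>?T. ennreal (p * v I \<sigma>) * u (full_pattern d I \<sigma> i)) =
          (\<Sum>(I, \<sigma>)\<in>?T. ennreal (p * v I \<sigma>)) * u s"
        unfolding sum_distrib_right by (auto intro!: sum.cong)
      also have "(\<Sum>(I, \<sigma>)\<in>?T. ennreal (p * v I \<sigma>)) = ennreal (W s)"
        unfolding W_def case_prod_unfold using v p by (intro sum_ennreal) auto
      finally show "(\<Sum>(I, \<sigma>)\<in>?T. ennreal (p * v I \<sigma>) * u (full_pattern d I \<sigma> i)) = ennreal (W s) * u s" .
    qed
    also have "ennreal (base_mass d p v) * u Middle + (\<Sum>s\<in>UNIV. ennreal (W s) * u s) =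
        (\<Sum>s\<in>UNIV. ennreal (cell_length p s) * u s)"
    proof -
      have "ennreal (base_mass d p v) * u Middle + ennreal (W Middle) * u Middle =
          ennreal (1 - 2 * p) * u Middle"
        using base W0 by (simp add: distrib_right[symmetric] ennreal_plus[symmetric] middle del: ennreal_plus)
      then show ?thesis
        using side[of Lower] side[of Upper]
        by (simp add: UNIV_level cell_length_def sides_def ac_simps)
    qed
    also have "\<dots> = emeasure uniform01 A"
      unfolding u_def by (rule uniform01_eq_cell_mixture[OF p A])
    finally show "emeasure (distr ?M borel (\<lambda>x. x i)) A = emeasure uniform01 A" .
  qed simp
qed

text \<open>
  Taking the coefficients themselves as mixture weights works: the margin conditions on \<open>lam\<close> are
  the ones that make the mixture a copula law, and its cell probabilities are \<open>p\<close> times the weights, so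
  summing over extensions returns \<open>lam\<close>.
\<close>

lemma conditions_imp_geometric_witness:
  assumes d: "d \<ge> 1" and p: "0 < p" "p < 1 / 2"
    and w: "w = triangular_inversion d lam"
    and nonneg: "\<And>I \<sigma>. (I, \<sigma>) \<in> signed_sets d \<Longrightarrow> w I \<sigma> \<ge> 0"
    and one: "\<And>i s. i \<in> {1..d} \<Longrightarrow> s \<in> sides \<Longrightarrow> lam {i} (\<lambda>_\<in>{i}. s) = 1"
    and mass: "p * (\<Sum>(I, \<sigma>)\<in>signed_sets d. w I \<sigma>) \<le> 1"
  shows "\<exists>C. geometric_witness_copula d p C \<and> has_tail_family d p C lam"
proof -
  let ?M = "witness_law d p w"
  define C where "C u = measure ?M (\<Pi>\<^sub>E i\<in>{1..d}. {..u i})" for u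
  have df: "has_df d ?M C"
    by (simp add: has_df_def C_def)
  have base: "base_mass d p w \<ge> 0"
    using mass by (simp add: base_mass_def)
  have "(\<Sum>(K, \<rho>)\<in>extensions d {i} (\<lambda>_\<in>{i}. s). w K \<rho>) = 1" if "i \<in> {1..d}" "s \<in> sides" for i s
    using sum_extensions_triangular_inversion[OF singleton_signed_set[OF that], of lam] one[OF that]
    by (simp add: w)
  then have margins: "uniform_margins d ?M"
    by (intro uniform_margins_witness_law[OF p nonneg base])
  have "geometric_witness_copula d p C"
    unfolding geometric_witness_copula_def using nonneg base margins df by blast
  moreover have "has_tail_family d p C lam"
  proof -
    have "law_of d C = ?M"
      by (rule law_of_eq[OF copula_law_witness_law[OF d margins] df])
    then have "cell_prob d p C (full_pattern d K \<rho>) / p = w K \<rho>" if "(K, \<rho>) \<in> signed_sets d" for K \<rho>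
      using measure_witness_law_box[OF p nonneg that] p by (simp add: cell_prob_def)
    then have "tail_family d p C J \<tau> = lam J \<tau>" if "(J, \<tau>) \<in> signed_sets d" for J \<tau>
      unfolding tail_family_eq_sum_extensions[OF that]
        sum_extensions_triangular_inversion[OF that, of lam, symmetric] w[symmetric]
      by (intro sum.cong) (auto simp: extensions_def)
    then show ?thesis by (auto simp: has_tail_family_def)
  qed
  ultimately show ?thesis by blast
qed

section \<open>The equivalence\<close>

theorem theorem2:
  fixes d :: nat and p :: real and lam w :: signed_family
  assumes "d \<ge> 1" and "0 < p" and "p < 1 / 2"
    and "w = triangular_inversion d lam"
  shows
    "((\<exists>C. copula d C \<and> has_tail_family d p C lam) \<longleftrightarrow>
        (\<forall>(I, \<sigma>)\<in>signed_sets d. w I \<sigma> \<ge> 0)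
        \<and> (\<forall>i\<in>{1..d}. lam {i} (\<lambda>_\<in>{i}. Lower) = 1 \<and> lam {i} (\<lambda>_\<in>{i}. Upper) = 1)
        \<and> p * (\<Sum>(I, \<sigma>)\<in>signed_sets d. w I \<sigma>) \<le> 1)
     \<and> ((\<exists>C. copula d C \<and> has_tail_family d p C lam) \<longleftrightarrow>
        (\<exists>C. geometric_witness_copula d p C \<and> has_tail_family d p C lam))"
    (is "(?copula \<longleftrightarrow> ?conditions) \<and> (_ \<longleftrightarrow> ?witness)")
proof -
  have 12: ?conditions if copula: ?copula
  proof -
    from copula obtain C where C: "copula d C" "has_tail_family d p C lam"
      by blast
    note conditions = copula_tail_family_conditions[OF assms(2,3) C, folded assms(4)]
    have "lam {i} (\<lambda>_\<in>{i}. Lower) = 1 \<and> lam {i} (\<lambda>_\<in>{i}. Upper) = 1" if "i \<in> {1..d}" for i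
      using conditions(2)[OF that] by (simp add: sides_def)
    then show ?conditions using conditions(1,3) by blast
  qed
  have 23: ?witness if cond: ?conditions
  proof (rule conditions_imp_geometric_witness[OF assms])
    show "w I \<sigma> \<ge> 0" if "(I, \<sigma>) \<in> signed_sets d" for I \<sigma>
      using cond that by blast
    show "lam {i} (\<lambda>_\<in>{i}. s) = 1" if "i \<in> {1..d}" "s \<in> sides" for i s
      using cond that unfolding sides_def by blast
    show "p * (\<Sum>(I, \<sigma>)\<in>signed_sets d. w I \<sigma>) \<le> 1"
      using cond by blast
  qed
  have 31: ?copula if ?witness
    using that geometric_witness_copula_is_copula[OF assms(1)] by blast
  from 12 23 31 show ?thesis by blast
qed

end
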